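(* Let $\mathcal{C}_k$ be a generator of a sparsity model $\mathcal{M}(\mathcal{C}_k)$ of order $k\in\mathbb{N}$ on $[p]$, let $r>0$, and let $f:\mathcal{H}\to\mathbb{R}$ be a twice continuously differentiable function that satisfies the $(\alpha_{\mathcal{C}_k^3},\beta_{\mathcal{C}_k^3},r)$-SMRH condition with respect to the model $\mathcal{M}(\mathcal{C}_k^3)$. Put $\mu_{\mathcal{C}_k^3}:=\alpha_{\mathcal{C}_k^3}/\beta_{\mathcal{C}_k^3}$ and $\eta^\star=2/(\alpha_{\mathcal{C}_k^3}+\beta_{\mathcal{C}_k^3})$. Let $\overline{\theta}\in\mathcal{H}$ with $\operatorname{supp}(\overline{\theta})\in\mathcal{M}(\mathcal{C}_k)$ and $\|\overline{\theta}\|\le r$, and let $\overline{\mathcal{I}}=\operatorname{supp}\left(\mathrm{P}_{\mathcal{C}_k^2,r}\left[\nabla f(\overline{\theta})\right]\right)$. Fix a step size $\eta>0$ and let $\theta^{(0)}=0$, $\theta^{(i+1)}=\mathrm{P}_{\mathcal{C}_k,r}\left[\theta^{(i)}-\eta\nabla f(\theta^{(i)})\right]$ for $i\ge0$ be the iterates of projected gradient descent. Set $$\gamma=\frac{\eta}{\eta^\star}\cdot\frac{\mu_{\mathcal{C}_k^3}-1}{\mu_{\mathcal{C}_k^3}+1}+\left|\frac{\eta}{\eta^\star}-1\right|.$$ If $2\gamma\ne1$, then for every $i\ge 0$, $$\left\|\theta^{(i)}-\overline{\theta}\right\|\le(2\gamma)^i\left\|\overline{\theta}\right\|+2\eta\,\frac{1-(2\gamma)^i}{1-2\gamma}\left\|\nabla_{\overline{\mathcal{I}}}f(\overline{\theta})\right\|.$$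 In particular, if either (i) $\mu_{\mathcal{C}_k^3}<3$ and $\eta=\eta^\star$, or (ii) $\mu_{\mathcal{C}_k^3}<\frac32$ and $\eta\in\left[1/\alpha_{\mathcal{C}_k^3},\,1/\beta_{\mathcal{C}_k^3}\right]$, then $2\gamma<1$, and the distance from the iterates to $\overline{\theta}$ shrinks with contraction factor $2\gamma$ up to an approximation error bounded above by $\frac{2\eta}{1-2\gamma}\left\|\nabla_{\overline{\mathcal{I}}}f(\overline{\theta})\right\|$; that is, for every $i\ge0$, $$\left\|\theta^{(i)}-\overline{\theta}\right\|\le(2\gamma)^i\left\|\overline{\theta}\right\|+\frac{2\eta}{1-2\gamma}\left\|\nabla_{\overline{\mathcal{I}}}f(\overline{\theta})\right\|.$$
   Context: Setting: $\mathcal{H}$ is a $p$-dimensional real Hilbert space with inner product $\langle\cdot,\cdot\rangle$ and induced norm $\|\cdot\|$; coordinates are taken with respect to a fixed orthonormal basis (so $\mathcal{H}$ may be identified with Euclidean $\mathbb{R}^p$). $[p]=\{1,\dots,p\}$. $\operatorname{supp}(x)$ is the set of indices of non-zero coordinates of $x$. For $\mathcal{I}\subseteq[p]$, $\nabla_{\mathcal{I}}f(\theta)$ is the restriction of the gradient $\nabla f(\theta)$ to the coordinates in $\mathcal{I}$; $\nabla^2 f$ is the Hessian. Sparsity model: let $k$ and $p$ be positive integers (with $k\ll p$, informally; no quantitative condition is meant) and let $\mathcal{C}_k$ be a (non-empty) family of non-empty subsets of $[p]$ of cardinality at most $k$. The sparsity model of order $k$ generated by $\mathcal{C}_k$ is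 $\mathcal{M}(\mathcal{C}_k)=\bigcup_{\mathcal{S}\in\mathcal{C}_k}2^{\mathcal{S}}$, where $2^{\mathcal{S}}$ is the power set of $\mathcal{S}$. For families of sets, $\mathcal{F}_1\Cup\mathcal{F}_2=\{X_1\cup X_2: X_1\in\mathcal{F}_1, X_2\in\mathcal{F}_2\}$, and $\mathcal{C}_k^2=\mathcal{C}_k\Cup\mathcal{C}_k$, $\mathcal{C}_k^3=\mathcal{C}_k\Cup\mathcal{C}_k\Cup\mathcal{C}_k$; the models $\mathcal{M}(\mathcal{C}_k^2)$, $\mathcal{M}(\mathcal{C}_k^3)$ are defined by the same formula. Projection: for a generator $\mathcal{C}$ and $r>0$, $\mathrm{P}_{\mathcal{C},r}[\theta_0]$ denotes a solution (any choice of minimizer) of: minimize $\|\theta-\theta_0\|$ over $\theta\in\mathcal{H}$ subject to $\operatorname{supp}(\theta)\in\mathcal{M}(\mathcal{C})$ and $\|\theta\|\le r$. SMRH (Stable Model-Restricted Hessian): for a generator $\mathcal{C}$, let $\alpha_{\mathcal{C}}$ be the smallest and $\beta_{\mathcal{C}}$ the largest positive real numbers such that $$\beta_{\mathcal{C}}\|\Delta\|^2\le\langle\Delta,\nabla^2 f(\theta)\Delta\rangle\le\alpha_{\mathcal{C}}\|\Delta\|^2$$ for all $\Delta,\theta\in\mathcal{H}$ with $\operatorname{supp}(\Delta)\cup\operatorname{supp}(\theta)\in\mathcal{M}(\mathcal{C})$ and $\|\theta\|\le r$. When such positive numbers exist, the twice continuously differentiable function $f$ is said to satisfy $(\alpha_{\mathcal{C}},\beta_{\mathcal{C}},r)$-SMRH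 with respect to $\mathcal{M}(\mathcal{C})$. *)

theory Defs
  imports "HOL-Analysis.Analysis"
begin

text \<open>
  The \<open>p\<close>-dimensional real Hilbert space with a fixed orthonormal basis is \<^typ>\<open>real ^ 'n\<close>;
  the finite index type \<open>'n\<close> plays the role of \<open>[p]\<close>, with \<open>p = CARD('n)\<close>.
\<close>

definition supp :: "real ^ 'n \<Rightarrow> 'n set" where
  "supp x = {i. x $ i \<noteq> 0}"

definition nabla :: "(real ^ 'n \<Rightarrow> real) \<Rightarrow> real ^ 'n \<Rightarrow> real ^ 'n" where
  "nabla f x = (THE g. GDERIV f x :> g)"

definition hessian :: "(real ^ 'n \<Rightarrow> real) \<Rightarrow> real ^ 'n \<Rightarrow> real ^ 'n ^ 'n" where
  "hessian f x = matrix (frechet_derivative (nabla f) (at x))"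

definition twice_cont_differentiable :: "(real ^ 'n \<Rightarrow> real) \<Rightarrow> bool" where
  "twice_cont_differentiable f \<longleftrightarrow>
     f differentiable_on UNIV \<and> nabla f differentiable_on UNIV \<and> continuous_on UNIV (hessian f)"

text \<open>
  The restriction to the coordinates in \<open>I\<close> is kept in the ambient space by padding with zeros,
  which does not affect its norm.
\<close>

definition restrict_coords :: "'n set \<Rightarrow> real ^ 'n \<Rightarrow> real ^ 'n" where
  "restrict_coords I x = (\<chi> i. if i \<in> I then x $ i else 0)"

definition is_generator :: "nat \<Rightarrow> 'n set set \<Rightarrow> bool" where
  "is_generator k C \<longleftrightarrow> C \<noteq> {} \<and> (\<forall>S\<in>C. S \<noteq> {} \<and> finite S \<and> card S \<le> k)"

definition sparsity_model :: "'n set set \<Rightarrow> 'n set set" where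
  "sparsity_model C = (\<Union>S\<in>C. Pow S)"

definition family_join :: "'n set set \<Rightarrow> 'n set set \<Rightarrow> 'n set set" where
  "family_join F G = {X \<union> Y | X Y. X \<in> F \<and> Y \<in> G}"

text \<open>
  Minimizers need not be unique, so the projection is a relation:
  \<open>is_projection C r x0 x\<close> says that \<open>x\<close> is one of the solutions.
\<close>

definition is_projection ::
    "'n set set \<Rightarrow> real \<Rightarrow> real ^ 'n \<Rightarrow> real ^ 'n \<Rightarrow> bool" where
  "is_projection C r x0 x \<longleftrightarrow>
     is_arg_min (\<lambda>\<theta>. norm (\<theta> - x0)) (\<lambda>\<theta>. supp \<theta> \<in> sparsity_model C \<and> norm \<theta> \<le> r) x"

definition hessian_bounds ::
    "(real ^ 'n \<Rightarrow> real) \<Rightarrow> 'n set set \<Rightarrow> real \<Rightarrow> real \<Rightarrow> real \<Rightarrow> bool" where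
  "hessian_bounds f C r a b \<longleftrightarrow> 0 < a \<and> 0 < b \<and>
     (\<forall>\<Delta> \<theta>. supp \<Delta> \<union> supp \<theta> \<in> sparsity_model C \<and> norm \<theta> \<le> r \<longrightarrow>
        b * (norm \<Delta>)\<^sup>2 \<le> \<Delta> \<bullet> (hessian f \<theta> *v \<Delta>) \<and>
        \<Delta> \<bullet> (hessian f \<theta> *v \<Delta>) \<le> a * (norm \<Delta>)\<^sup>2)"

definition SMRH ::
    "(real ^ 'n \<Rightarrow> real) \<Rightarrow> 'n set set \<Rightarrow> real \<Rightarrow> real \<Rightarrow> real \<Rightarrow> bool" where
  "SMRH f C r \<alpha> \<beta> \<longleftrightarrow> twice_cont_differentiable f \<and> hessian_bounds f C r \<alpha> \<beta> \<and>
     (\<forall>a b. hessian_bounds f C r a b \<longrightarrow> \<alpha> \<le> a \<and> b \<le> \<beta>)"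

lemma GDERIV_nabla:
  assumes "f differentiable (at x)"
  shows "GDERIV f x :> nabla f x"
proof -
  obtain f' where f': "(f has_derivative f') (at x)"
    using assms unfolding differentiable_def by blast
  then have lin: "linear f'" by (rule has_derivative_linear)
  have "f' h = h \<bullet> adjoint f' 1" for h
    using adjoint_works[OF lin, of h 1] by simp
  then have eq: "f' = (\<lambda>h. h \<bullet> adjoint f' 1)" by (rule ext)
  have ex: "GDERIV f x :> adjoint f' 1"
    unfolding gderiv_def using f' eq
    by (rule back_subst[where P = "\<lambda>D. (f has_derivative D) (at x)"])
  have uniq: "g = adjoint f' 1" if "GDERIV f x :> g" for g
  proof -
    have "(\<lambda>h. h \<bullet> g) = (\<lambda>h. h \<bullet> adjoint f' 1)"
      using that ex unfolding gderiv_def by (rule has_derivative_unique)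
    then have "\<forall>h. h \<bullet> g = h \<bullet> adjoint f' 1" by (intro allI) (rule fun_cong)
    then show ?thesis by (rule vector_eq_ldot[THEN iffD1])
  qed
  show ?thesis unfolding nabla_def using ex uniq by (rule theI)
qed

lemma hessian_has_derivative:
  assumes "nabla f differentiable (at x)"
  shows "(nabla f has_derivative (\<lambda>h. hessian f x *v h)) (at x)"
proof -
  have d: "(nabla f has_derivative frechet_derivative (nabla f) (at x)) (at x)"
    using assms by (rule frechet_derivative_works[THEN iffD1])
  have "(*v) (hessian f x) = frechet_derivative (nabla f) (at x)"
    unfolding hessian_def
    by (rule matrix_vector_mul(2)[OF linear_frechet_derivative[OF assms]])
  with d show ?thesis by (simp only:)
qed

end

theory Submission
  imports Defs
begin

text \<open>
  Write \<open>J\<close> for the union of the supports of \<open>\<theta>\<^sup>i\<^sup>+\<^sup>1\<close> and \<open>\<theta>bar\<close>.  Comparing the projection with the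
  feasible point \<open>\<theta>bar\<close> gives
  \<open>\<parallel>\<theta>\<^sup>i\<^sup>+\<^sup>1 - \<theta>bar\<parallel> \<le> 2 \<parallel>(\<theta>\<^sup>i - \<eta> \<nabla>f(\<theta>\<^sup>i) - \<theta>bar)\<^sub>J\<parallel>\<close>.  By the mean value theorem, the part
  \<open>\<theta>\<^sup>i - \<theta>bar - \<eta> (\<nabla>f(\<theta>\<^sup>i) - \<nabla>f(\<theta>bar))\<close>, tested against a vector supported in \<open>J\<close>, is a value of
  the bilinear form of \<open>I - \<eta> \<nabla>\<^sup>2f\<close> at a point of the segment.  This form is symmetric, so by polarization
  its norm is controlled by the SMRH bounds, with factor \<open>\<gamma>\<close>.  The remaining part \<open>\<eta> \<nabla>\<^sub>Jf(\<theta>bar)\<close> is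
  dominated by the restriction to \<open>Ibar\<close>, because a projection onto the model selects coordinates
  that maximize the norm of the restriction.
\<close>

section \<open>Symmetry of the second derivative and norms of symmetric forms\<close>

text \<open>The second difference over the parallelogram spanned by \<open>a\<close> and
  \<open>b\<close> is the increment of \<open>f (x + a + s b) - f (x + s b)\<close> from
  \<open>s = 0\<close> to \<open>s = 1\<close>. The mean value theorem turns it into a difference of
  two gradients, each of which is linearized at \<open>x\<close>.\<close>

lemma second_difference_bound:
  fixes f :: "'a::real_inner \<Rightarrow> real"
  assumes g: "\<And>y. GDERIV f y :> g y" and H: "linear H"
    and rem: "\<And>h. norm h < d \<Longrightarrow> norm (g (x + h) - g x - H h) \<le> e * norm h"
    and small: "norm a + norm b < d" and "e \<ge> 0"
  shows "\<bar>f (x + a + b) - f (x + a) - f (x + b) + f x - b \<bullet> H a\<bar> \<le> 2 * e * (norm a + norm b)\<^sup>2"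
proof -
  define \<phi> where "\<phi> s = f (x + a + s *\<^sub>R b) - f (x + s *\<^sub>R b)" for s
  have fd: "(f has_derivative (\<lambda>h. h \<bullet> g y)) (at y)" for y
    using g[of y] unfolding gderiv_def .
  have "(\<phi> has_derivative (\<lambda>h. (h *\<^sub>R b) \<bullet> g (x + a + s *\<^sub>R b) - (h *\<^sub>R b) \<bullet> g (x + s *\<^sub>R b)))
      (at s within {0..1})" for s
    unfolding \<phi>_def
    by (rule has_derivative_diff; rule has_derivative_compose[OF _ fd])
      (auto intro!: derivative_eq_intros)
  from mvt_simple[OF zero_less_one this] obtain s where s: "s \<in> {0<..<1}"
    and eq: "\<phi> 1 - \<phi> 0 = b \<bullet> g (x + a + s *\<^sub>R b) - b \<bullet> g (x + s *\<^sub>R b)"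
    by auto
  define R where "R h = g (x + h) - g x - H h" for h
  have sb: "norm (s *\<^sub>R b) \<le> norm b"
    using s by (simp add: mult_left_le_one_le)
  have n1: "norm (a + s *\<^sub>R b) \<le> norm a + norm b" and n2: "norm (s *\<^sub>R b) \<le> norm a + norm b"
    using sb norm_triangle_ineq[of a "s *\<^sub>R b"] norm_ge_zero[of a] by linarith+
  have R1: "norm (R (a + s *\<^sub>R b)) \<le> e * (norm a + norm b)"
    using rem[of "a + s *\<^sub>R b"] n1 small mult_left_mono[OF n1 \<open>e \<ge> 0\<close>] unfolding R_def by linarith
  have R2: "norm (R (s *\<^sub>R b)) \<le> e * (norm a + norm b)"
    using rem[of "s *\<^sub>R b"] n2 small mult_left_mono[OF n2 \<open>e \<ge> 0\<close>] unfolding R_def by linarith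
  have "f (x + a + b) - f (x + a) - f (x + b) + f x - b \<bullet> H a = \<phi> 1 - \<phi> 0 - b \<bullet> H a"
    by (simp add: \<phi>_def)
  \<comment> \<open>The contributions \<open>H (s b)\<close> of the two linearizations cancel, so
    only \<open>H a\<close> and the remainders survive.\<close>
  also have "\<dots> = b \<bullet> (R (a + s *\<^sub>R b) - R (s *\<^sub>R b))"
    unfolding eq R_def by (simp add: linear_add[OF H] inner_simps add.assoc)
  finally have "\<bar>f (x + a + b) - f (x + a) - f (x + b) + f x - b \<bullet> H a\<bar>
      \<le> norm b * norm (R (a + s *\<^sub>R b) - R (s *\<^sub>R b))"
    by (simp add: Cauchy_Schwarz_ineq2)
  \<comment> \<open>The factor \<open>norm b\<close> is enlarged to \<open>norm a + norm b\<close>,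
    which makes the bound symmetric in \<open>a\<close> and \<open>b\<close>.\<close>
  also have "\<dots> \<le> (norm a + norm b) * (2 * e * (norm a + norm b))"
    using R1 R2 norm_triangle_ineq4[of "R (a + s *\<^sub>R b)" "R (s *\<^sub>R b)"]
    by (intro mult_mono) auto
  finally show ?thesis by (simp add: power2_eq_square mult_ac)
qed

text \<open>Swapping \<open>a\<close> and \<open>b\<close> leaves the second difference unchanged,
  so \<open>b \<bullet> H a\<close> and \<open>a \<bullet> H b\<close> approximate the same number.
  After scaling both vectors by a small \<open>t\<close>, the factor \<open>t^2\<close> cancels and
  the discrepancy is an arbitrarily small multiple of \<open>K\<close>.\<close>

lemma gradient_derivative_symmetric:
  fixes f :: "'a::real_inner \<Rightarrow> real"
  assumes g: "\<And>y. GDERIV f y :> g y" and H: "(g has_derivative H) (at x)"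
  shows "a \<bullet> H b = b \<bullet> H a"
proof -
  have lin: "linear H" using H by (rule has_derivative_linear)
  define K where "K = 4 * (norm a + norm b)\<^sup>2"
  have bound: "\<bar>b \<bullet> H a - a \<bullet> H b\<bar> \<le> K * e" if "e > 0" for e
  proof -
    obtain d where "d > 0"
      and d: "\<And>y. norm (y - x) < d \<Longrightarrow> norm (g y - g x - H (y - x)) \<le> e * norm (y - x)"
      using H \<open>e > 0\<close> unfolding has_derivative_at_alt by blast
    have rem: "norm (g (x + h) - g x - H h) \<le> e * norm h" if "norm h < d" for h
      using d[of "x + h"] that by simp
    \<comment> \<open>This choice puts the scaled vectors within radius \<open>d\<close>; the
      summand 1 covers \<open>a = b = 0\<close>.\<close>
    define t where "t = d / 2 / (norm a + norm b + 1)"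
    have pos: "norm a + norm b + 1 > 0" by (simp add: add_nonneg_pos)
    have "t > 0" unfolding t_def using \<open>d > 0\<close> pos by simp
    have "t * (norm a + norm b + 1) = d / 2" 
      unfolding t_def by (rule nonzero_eq_divide_eq[THEN iffD1, OF _ refl]) (use pos in simp)
    then have tlt: "norm (t *\<^sub>R a) + norm (t *\<^sub>R b) < d"
      using \<open>t > 0\<close> \<open>d > 0\<close> by (simp add: algebra_simps)
    have nn: "norm (t *\<^sub>R a) + norm (t *\<^sub>R b) = t * (norm a + norm b)"
      using \<open>t > 0\<close> by (simp add: algebra_simps)
    have form: "(t *\<^sub>R u) \<bullet> H (t *\<^sub>R w) = t\<^sup>2 * (u \<bullet> H w)" for u w
      by (simp add: linear_scale[OF lin] power2_eq_square)
    have 1: "\<bar>f (x + t *\<^sub>R a + t *\<^sub>R b) - f (x + t *\<^sub>R a) - f (x + t *\<^sub>R b) + f x - t\<^sup>2 * (b \<bullet> H a)\<bar>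
        \<le> 2 * e * (t * (norm a + norm b))\<^sup>2"
      using second_difference_bound[OF g lin rem tlt] \<open>e > 0\<close> by (simp only: nn form less_imp_le)
    have tlt': "norm (t *\<^sub>R b) + norm (t *\<^sub>R a) < d" using tlt by simp
    have nn': "norm (t *\<^sub>R b) + norm (t *\<^sub>R a) = t * (norm a + norm b)" using nn by simp
    have 2: "\<bar>f (x + t *\<^sub>R b + t *\<^sub>R a) - f (x + t *\<^sub>R b) - f (x + t *\<^sub>R a) + f x - t\<^sup>2 * (a \<bullet> H b)\<bar>
        \<le> 2 * e * (t * (norm a + norm b))\<^sup>2"
      using second_difference_bound[OF g lin rem tlt'] \<open>e > 0\<close> by (simp only: nn' form less_imp_le)
    have "x + t *\<^sub>R b + t *\<^sub>R a = x + t *\<^sub>R a + t *\<^sub>R b" by (simp add: add_ac)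
    note 2 = 2[unfolded this]
    have "t\<^sup>2 * \<bar>b \<bullet> H a - a \<bullet> H b\<bar> = \<bar>t\<^sup>2 * (b \<bullet> H a) - t\<^sup>2 * (a \<bullet> H b)\<bar>"
      by (simp add: abs_mult flip: right_diff_distrib)
    also have "\<dots> \<le> 4 * e * (t * (norm a + norm b))\<^sup>2" using 1 2 by linarith
    also have "\<dots> = t\<^sup>2 * (K * e)" by (simp add: K_def power_mult_distrib)
    finally show ?thesis using \<open>t > 0\<close> by simp
  qed
  have "\<bar>b \<bullet> H a - a \<bullet> H b\<bar> \<le> 0 + e" if "e > 0" for e
  proof -
    have "K \<ge> 0" by (simp add: K_def)
    \<comment> \<open>Dividing by \<open>K + 1\<close> rather than \<open>K\<close> allows for
      \<open>K = 0\<close>.\<close>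
    have "\<bar>b \<bullet> H a - a \<bullet> H b\<bar> \<le> K * (e / (K + 1))"
      using bound[of "e / (K + 1)"] \<open>e > 0\<close> \<open>K \<ge> 0\<close> by simp
    also have "\<dots> \<le> e" using \<open>e > 0\<close> \<open>K \<ge> 0\<close> by (simp add: field_simps)
    finally show ?thesis by simp
  qed
  then have "\<bar>b \<bullet> H a - a \<bullet> H b\<bar> \<le> 0" by (rule field_le_epsilon)
  then show ?thesis by simp
qed

text \<open>For unit vectors, polarization writes \<open>4 * (u \<bullet> M w)\<close> as a
  difference of the quadratic form at \<open>u + w\<close> and \<open>u - w\<close>, and the
  parallelogram law bounds it by \<open>4 * c\<close>. Normalizing gives the general case.\<close>

lemma symmetric_form_bound:
  fixes M :: "'a::real_inner \<Rightarrow> 'a"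
  assumes M: "linear M" and sym: "\<And>u w. u \<bullet> M w = w \<bullet> M u"
    and V: "subspace V" and q: "\<And>u. u \<in> V \<Longrightarrow> \<bar>u \<bullet> M u\<bar> \<le> c * (norm u)\<^sup>2"
    and "u \<in> V" "w \<in> V"
  shows "\<bar>u \<bullet> M w\<bar> \<le> c * norm u * norm w"
proof -
  have unit: "\<bar>u \<bullet> M w\<bar> \<le> c" if "u \<in> V" "w \<in> V" "norm u = 1" "norm w = 1" for u w
  proof -
    have "4 * (u \<bullet> M w) = (u + w) \<bullet> M (u + w) - (u - w) \<bullet> M (u - w)"
      using sym[of w u] by (simp add: linear_add[OF M] linear_diff[OF M] inner_simps)
    also have "\<bar>\<dots>\<bar> \<le> c * (norm (u + w))\<^sup>2 + c * (norm (u - w))\<^sup>2"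
      using q[of "u + w"] q[of "u - w"] that(1,2) subspace_add[OF V] subspace_diff[OF V]
      by (smt (verit))
    also have "\<dots> = c * (2 * (norm u)\<^sup>2 + 2 * (norm w)\<^sup>2)"
      unfolding power2_norm_eq_inner by (simp add: inner_simps inner_commute algebra_simps)
    finally show ?thesis using that(3,4) by simp
  qed
  show ?thesis
  proof (cases "u = 0 \<or> w = 0")
    case True
    then show ?thesis by (auto simp: linear_0[OF M])
  next
    case False
    have "\<bar>(u /\<^sub>R norm u) \<bullet> M (w /\<^sub>R norm w)\<bar> \<le> c"
      using False assms(5,6) by (intro unit) (auto intro: subspace_scale[OF V])
    then have "\<bar>u \<bullet> M w\<bar> / (norm u * norm w) \<le> c"
      by (simp add: linear_scale[OF M] abs_mult divide_inverse mult_ac)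
    then show ?thesis using False by (simp add: divide_le_eq mult_ac)
  qed
qed

section \<open>Supports, coordinate restrictions and sparsity models\<close>

lemma supp_subset_iff: "supp x \<subseteq> U \<longleftrightarrow> (\<forall>i. i \<notin> U \<longrightarrow> x $ i = 0)"
  by (auto simp: supp_def)

lemma subspace_supp: "subspace {x. supp x \<subseteq> U}"
  by (auto simp: subspace_def supp_subset_iff)

lemma supp_diff: "supp (x - y) \<subseteq> supp x \<union> supp y"
  by (auto simp: supp_def)

lemma supp_restrict_coords: "supp (restrict_coords I x) \<subseteq> I"
  by (auto simp: supp_def restrict_coords_def)

lemma restrict_coords_diff: "restrict_coords I (x - y) = restrict_coords I x - restrict_coords I y"
  by (simp add: restrict_coords_def vec_eq_iff)

lemma restrict_coords_scale: "restrict_coords I (c *\<^sub>R x) = c *\<^sub>R restrict_coords I x"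
  by (simp add: restrict_coords_def vec_eq_iff)

lemma inner_restrict_coords: "supp x \<subseteq> I \<Longrightarrow> x \<bullet> restrict_coords I y = x \<bullet> y"
  unfolding inner_vec_def
  by (intro sum.cong refl) (auto simp: restrict_coords_def supp_subset_iff)

lemma inner_restrict_coords_self:
  "restrict_coords I x \<bullet> x = (norm (restrict_coords I x))\<^sup>2"
  by (metis inner_restrict_coords power2_norm_eq_inner supp_restrict_coords)

lemma sparsity_model_mono: "U \<in> sparsity_model C \<Longrightarrow> V \<subseteq> U \<Longrightarrow> V \<in> sparsity_model C"
  by (auto simp: sparsity_model_def)

lemma sparsity_model_join:
  "U \<in> sparsity_model C \<Longrightarrow> V \<in> sparsity_model D \<Longrightarrow> U \<union> V \<in> sparsity_model (family_join C D)"
  unfolding sparsity_model_def family_join_def by blast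

section \<open>Projections onto a sparsity model\<close>

text \<open>Expanding the optimality of \<open>x\<close> against \<open>y\<close> gives
  \<open>norm (x - y) ^ 2 \<le> 2 * ((x - y) \<bullet> (z - y))\<close>, and \<open>x - y\<close>
  sees only the coordinates in \<open>J\<close>. This is the origin of the factor 2 in
  \<open>2 * \<gamma>\<close>.\<close>

lemma projection_error:
  assumes proj: "is_projection C r z x" and y: "supp y \<in> sparsity_model C" "norm y \<le> r"
    and J: "supp x \<union> supp y \<subseteq> J"
  shows "norm (x - y) \<le> 2 * norm (restrict_coords J (z - y))"
proof (cases "x = y")
  case False
  have "norm (x - z) \<le> norm (y - z)"
    using proj y unfolding is_projection_def is_arg_min_linorder by blast
  then have "(norm (x - z))\<^sup>2 \<le> (norm (y - z))\<^sup>2" by simp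
  then have "(norm (x - y))\<^sup>2 \<le> 2 * ((x - y) \<bullet> (z - y))"
    unfolding power2_norm_eq_inner by (simp add: inner_simps inner_commute algebra_simps)
  also have "(x - y) \<bullet> (z - y) = (x - y) \<bullet> restrict_coords J (z - y)"
    using supp_diff[of x y] J by (intro inner_restrict_coords[symmetric]) blast
  also have "\<dots> \<le> norm (x - y) * norm (restrict_coords J (z - y))"
    by (rule norm_cauchy_schwarz)
  finally show ?thesis using False by (simp add: power2_eq_square)
qed simp

text \<open>The norm constraint may be active, so \<open>x\<close> need not be a restriction of
  \<open>g\<close>. The comparison therefore uses multiples of \<open>restrict_coords S g\<close>:
  if this restriction were the larger one, a suitable multiple would be feasible and closer to
  \<open>g\<close> than \<open>x\<close>.\<close>

lemma projection_selects_largest_restriction: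
  assumes proj: "is_projection C r g x" and "r > 0" and S: "S \<in> sparsity_model C"
  shows "norm (restrict_coords S g) \<le> norm (restrict_coords (supp x) g)"
proof (rule ccontr)
  assume "\<not> ?thesis"
  then have less: "norm (restrict_coords (supp x) g) < norm (restrict_coords S g)" by simp
  define u where "u = restrict_coords S g"
  have "norm u > 0" using less norm_ge_zero order_le_less_trans unfolding u_def by blast
  have "supp (c *\<^sub>R u) \<subseteq> S" for c
    by (auto simp: u_def supp_def restrict_coords_def)
  then have opt: "norm (x - g) \<le> norm (c *\<^sub>R u - g)" if "norm (c *\<^sub>R u) \<le> r" for c
    using proj S that sparsity_model_mono
    unfolding is_projection_def is_arg_min_linorder by blast
  have "norm x \<le> r" using proj unfolding is_projection_def is_arg_min_linorder by blast
  have opt': "(norm x)\<^sup>2 - 2 * (x \<bullet> g) \<le> c\<^sup>2 * (norm u)\<^sup>2 - 2 * c * (norm u)\<^sup>2"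
    if "norm (c *\<^sub>R u) \<le> r" for c
  proof -
    have "(norm (x - g))\<^sup>2 \<le> (norm (c *\<^sub>R u - g))\<^sup>2" using opt[OF that] by simp
    moreover have "u \<bullet> g = (norm u)\<^sup>2" unfolding u_def by (rule inner_restrict_coords_self)
    ultimately show ?thesis
      unfolding power2_norm_eq_inner
      by (simp add: inner_simps inner_commute power2_eq_square algebra_simps)
  qed
  have xg: "x \<bullet> g \<le> norm x * norm (restrict_coords (supp x) g)"
    by (metis inner_restrict_coords norm_cauchy_schwarz order_refl)
  show False
  proof (cases "x = 0")
    case True
    \<comment> \<open>The bound \<open>r / norm u\<close> ensures feasibility;
      \<open>c \<le> 1\<close> makes \<open>c * (c - 2)\<close> negative, so the competitor beats
      0.\<close>
    define c where "c = min 1 (r / norm u)"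
    have c: "0 < c" "c \<le> 1" "c * norm u \<le> r"
      using \<open>r > 0\<close> \<open>norm u > 0\<close> unfolding c_def by (auto simp: min_def field_simps)
    have "0 \<le> (c * (c - 2)) * (norm u)\<^sup>2"
      using opt'[of c] c True by (simp add: power2_eq_square algebra_simps)
    moreover have "(c * (c - 2)) * (norm u)\<^sup>2 < 0"
      using c \<open>norm u > 0\<close> by (intro mult_neg_pos mult_pos_neg) auto
    ultimately show False by simp
  next
    case False
    \<comment> \<open>The competitor is scaled to the norm of \<open>x\<close>, so the squared norms
      cancel and only inner products with \<open>g\<close> are compared.\<close>
    have "(norm x)\<^sup>2 - 2 * (x \<bullet> g) \<le> (norm x)\<^sup>2 - 2 * (norm x * norm u)"
      using opt'[of "norm x / norm u"] \<open>norm x \<le> r\<close> \<open>norm u > 0\<close>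
      by (simp add: power2_eq_square)
    then have "norm x * norm u \<le> norm x * norm (restrict_coords (supp x) g)"
      using xg by simp
    then show False using False less unfolding u_def by simp
  qed
qed

section \<open>Contraction of the gradient step\<close>

lemma gradient_step_contraction:
  assumes tcd: "twice_cont_differentiable f" and hb: "hessian_bounds f D r \<alpha> \<beta>"
    and U: "U \<in> sparsity_model D"
    and xy: "supp x \<subseteq> U" "supp y \<subseteq> U" "norm x \<le> r" "norm y \<le> r" and J: "J \<subseteq> U"
    and "\<eta> \<ge> 0" and c: "\<bar>1 - \<eta> * \<alpha>\<bar> \<le> c" "\<bar>1 - \<eta> * \<beta>\<bar> \<le> c"
  shows "norm (restrict_coords J (x - y - \<eta> *\<^sub>R (nabla f x - nabla f y))) \<le> c * norm (x - y)"
proof -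
  define w where "w = x - y - \<eta> *\<^sub>R (nabla f x - nabla f y)"
  \<comment> \<open>Testing with \<open>v\<close> recovers the norm, since
    \<open>v \<bullet> w = norm v ^ 2\<close>, and makes the scalar mean value theorem applicable
    along the segment \<open>p\<close>.\<close>
  define v where "v = restrict_coords J w"
  define p where "p t = y + t *\<^sub>R (x - y)" for t :: real
  have gd: "GDERIV f z :> nabla f z" for z
    using tcd unfolding twice_cont_differentiable_def differentiable_on_def
    by (auto intro: GDERIV_nabla)
  have hd: "(nabla f has_derivative (\<lambda>h. hessian f z *v h)) (at z)" for z
    using tcd unfolding twice_cont_differentiable_def differentiable_on_def
    by (auto intro: hessian_has_derivative)
  \<comment> \<open>\<open>M z\<close> is the derivative at \<open>z\<close> of the map taking
    \<open>z\<close> to \<open>z - \<eta> *\<^sub>R nabla f z\<close>.\<close>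
  define M where "M z h = h - \<eta> *\<^sub>R (hessian f z *v h)" for z h
  have p_der: "(p has_derivative (\<lambda>h. h *\<^sub>R (x - y))) (at t within {0..1})" for t
    unfolding p_def by (auto intro!: derivative_eq_intros)
  have "((\<lambda>t. v \<bullet> (p t - \<eta> *\<^sub>R nabla f (p t))) has_derivative (\<lambda>h. v \<bullet> M (p t) (h *\<^sub>R (x - y))))
      (at t within {0..1})" for t
    unfolding M_def
    by (intro has_derivative_inner_right has_derivative_diff has_derivative_scaleR_right p_der
        has_derivative_compose[OF p_der hd])
  from mvt_simple[OF zero_less_one this] obtain t where t: "t \<in> {0<..<1}"
    and "v \<bullet> (p 1 - \<eta> *\<^sub>R nabla f (p 1)) - v \<bullet> (p 0 - \<eta> *\<^sub>R nabla f (p 0)) = v \<bullet> M (p t) (x - y)"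
    by auto
  then have vw: "v \<bullet> w = v \<bullet> M (p t) (x - y)"
    by (simp add: p_def w_def inner_simps algebra_simps)
  have pt: "supp (p t) \<subseteq> U" using xy unfolding p_def supp_subset_iff by simp
  have "p t = (1 - t) *\<^sub>R y + t *\<^sub>R x" by (simp add: p_def algebra_simps)
  then have "p t \<in> cball 0 r"
    using convexD[OF convex_cball, of y 0 r x "1 - t" t] xy t by simp
  then have nt: "norm (p t) \<le> r" by simp
  have "\<bar>v \<bullet> M (p t) (x - y)\<bar> \<le> c * norm v * norm (x - y)"
  proof (rule symmetric_form_bound[where V = "{u. supp u \<subseteq> U}"])
    show "linear (M (p t))"
      unfolding M_def by (intro linearI) (simp_all add: matrix_vector_right_distrib algebra_simps)
    show "u \<bullet> M (p t) h = h \<bullet> M (p t) u" for u h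
      using gradient_derivative_symmetric[OF gd hd[of "p t"], of u h]
      by (simp add: M_def inner_simps inner_commute)
    show "subspace {u. supp u \<subseteq> U}" by (rule subspace_supp)
    \<comment> \<open>The form of \<open>M (p t)\<close> lies between
      \<open>1 - \<eta> * \<alpha>\<close> and \<open>1 - \<eta> * \<beta>\<close> times
      \<open>norm u ^ 2\<close>.\<close>
    show "\<bar>u \<bullet> M (p t) u\<bar> \<le> c * (norm u)\<^sup>2" if "u \<in> {u. supp u \<subseteq> U}" for u
    proof -
      define h where "h = u \<bullet> (hessian f (p t) *v u)"
      have "supp u \<union> supp (p t) \<in> sparsity_model D"
        using U that pt by (auto intro: sparsity_model_mono)
      then have "\<beta> * (norm u)\<^sup>2 \<le> h" "h \<le> \<alpha> * (norm u)\<^sup>2"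
        using hb nt unfolding hessian_bounds_def h_def by auto
      then have "\<eta> * (\<beta> * (norm u)\<^sup>2) \<le> \<eta> * h" "\<eta> * h \<le> \<eta> * (\<alpha> * (norm u)\<^sup>2)"
        using \<open>\<eta> \<ge> 0\<close> by (auto intro: mult_left_mono)
      moreover have "(1 - \<eta> * \<beta>) * (norm u)\<^sup>2 \<le> c * (norm u)\<^sup>2"
        "(-c) * (norm u)\<^sup>2 \<le> (1 - \<eta> * \<alpha>) * (norm u)\<^sup>2"
        using c by (intro mult_right_mono; simp)+
      moreover have "u \<bullet> M (p t) u = (norm u)\<^sup>2 - \<eta> * h"
        by (simp add: M_def h_def inner_simps power2_norm_eq_inner)
      ultimately show ?thesis by (simp add: algebra_simps abs_le_iff)
    qed
    show "v \<in> {u. supp u \<subseteq> U}" using supp_restrict_coords[of J w] J by (auto simp: v_def)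
    show "x - y \<in> {u. supp u \<subseteq> U}" using supp_diff[of x y] xy by blast
  qed
  then have "(norm v)\<^sup>2 \<le> c * norm v * norm (x - y)"
    using vw inner_restrict_coords_self[of J w] unfolding v_def by simp
  moreover have "c \<ge> 0" using c by linarith
  ultimately have "norm v \<le> c * norm (x - y)"
    by (cases "norm v = 0") (auto simp: power2_eq_square mult_ac)
  then show ?thesis by (simp add: v_def w_def)
qed

section \<open>Recursion for the error and the convergence rate\<close>

lemma affine_recursion_bound:
  fixes a :: "nat \<Rightarrow> real"
  assumes step: "\<And>i. a (Suc i) \<le> q * a i + b" and "q \<ge> 0" "q \<noteq> 1"
  shows "a i \<le> q ^ i * a 0 + b * ((1 - q ^ i) / (1 - q))"
proof (induction i)
  case (Suc i)
  have "a (Suc i) \<le> q * (q ^ i * a 0 + b * ((1 - q ^ i) / (1 - q))) + b"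
    using step[of i] mult_left_mono[OF Suc \<open>q \<ge> 0\<close>] by linarith
  also have "\<dots> = q ^ Suc i * a 0 + b * (q * ((1 - q ^ i) / (1 - q)) + 1)"
    by (simp add: distrib_left mult_ac)
  also have "q * ((1 - q ^ i) / (1 - q)) + 1 = (1 - q ^ Suc i) / (1 - q)"
    using \<open>q \<noteq> 1\<close> by (simp add: divide_add_eq_iff right_diff_distrib)
  finally show ?case .
qed simp

text \<open>Both bounds are tested on one coordinate vector at the origin.\<close>

lemma hessian_bounds_le:
  assumes hb: "hessian_bounds f D r \<alpha> \<beta>" and S: "S \<in> D" "S \<noteq> {}" and "r \<ge> 0"
  shows "\<beta> \<le> \<alpha>"
proof -
  obtain i where "i \<in> S" using S by blast
  have "supp (axis i (1 :: real)) \<union> supp 0 \<in> sparsity_model D"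
    using S(1) \<open>i \<in> S\<close> unfolding sparsity_model_def supp_def axis_def by (auto split: if_splits)
  then have "\<beta> * (norm (axis i (1 :: real)))\<^sup>2 \<le> h \<and> h \<le> \<alpha> * (norm (axis i (1 :: real)))\<^sup>2"
    if "h = axis i 1 \<bullet> (hessian f 0 *v axis i 1)" for h
    using hb \<open>r \<ge> 0\<close> unfolding hessian_bounds_def that by (simp only: norm_zero)
  then show ?thesis by force
qed

theorem corollary1:
  fixes f :: "real ^ 'n \<Rightarrow> real"
    and C :: "'n set set"
    and k :: nat
    and r \<alpha> \<beta> \<mu> \<eta>star \<eta> \<gamma> :: real
    and \<theta>bar proj_grad :: "real ^ 'n"
    and Ibar :: "'n set"
    and \<theta> :: "nat \<Rightarrow> real ^ 'n"
  assumes "k > 0"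
    and "is_generator k C"
    and "r > 0"
    and "twice_cont_differentiable f"
    and "SMRH f (family_join (family_join C C) C) r \<alpha> \<beta>"
    and "\<mu> = \<alpha> / \<beta>"
    and "\<eta>star = 2 / (\<alpha> + \<beta>)"
    and "supp \<theta>bar \<in> sparsity_model C"
    and "norm \<theta>bar \<le> r"
    and "is_projection (family_join C C) r (nabla f \<theta>bar) proj_grad"
    and "Ibar = supp proj_grad"
    and "\<eta> > 0"
    and "\<theta> 0 = 0"
    and "\<And>i. is_projection C r (\<theta> i - \<eta> *\<^sub>R nabla f (\<theta> i)) (\<theta> (Suc i))"
    and "\<gamma> = \<eta> / \<eta>star * ((\<mu> - 1) / (\<mu> + 1)) + \<bar>\<eta> / \<eta>star - 1\<bar>"
  shows "(2 * \<gamma> \<noteq> 1 \<longrightarrow>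
           (\<forall>i. norm (\<theta> i - \<theta>bar) \<le> (2 * \<gamma>) ^ i * norm \<theta>bar
              + 2 * \<eta> * ((1 - (2 * \<gamma>) ^ i) / (1 - 2 * \<gamma>))
                * norm (restrict_coords Ibar (nabla f \<theta>bar)))) \<and>
         ((\<mu> < 3 \<and> \<eta> = \<eta>star) \<or> (\<mu> < 3 / 2 \<and> \<eta> \<in> {1 / \<alpha>..1 / \<beta>}) \<longrightarrow>
           2 * \<gamma> < 1 \<and>
           (\<forall>i. norm (\<theta> i - \<theta>bar) \<le> (2 * \<gamma>) ^ i * norm \<theta>bar
              + 2 * \<eta> / (1 - 2 * \<gamma>) * norm (restrict_coords Ibar (nabla f \<theta>bar))))"
proof -
  define D where "D = family_join (family_join C C) C"
  define G where "G = norm (restrict_coords Ibar (nabla f \<theta>bar))"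
  have hb: "hessian_bounds f D r \<alpha> \<beta>" using assms(5) by (simp add: SMRH_def D_def)
  then have pos: "\<alpha> > 0" "\<beta> > 0" by (auto simp: hessian_bounds_def)
  obtain S where S: "S \<in> C" "S \<noteq> {}" using assms(2) by (auto simp: is_generator_def)
  \<comment> \<open>\<open>S\<close> itself reappears in the triple join, which provides a nonempty
    member of \<open>D\<close>.\<close>
  have "S \<union> S \<union> S \<in> D" using S unfolding D_def family_join_def by blast
  then have le: "\<beta> \<le> \<alpha>" using hessian_bounds_le[OF hb] S \<open>r > 0\<close> by simp
  have ratio: "(\<mu> - 1) / (\<mu> + 1) = (\<alpha> - \<beta>) / (\<alpha> + \<beta>)"
  proof -
    have "\<mu> - 1 = (\<alpha> - \<beta>) / \<beta>" "\<mu> + 1 = (\<alpha> + \<beta>) / \<beta>"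
      using pos assms(6) by (simp_all add: diff_divide_distrib add_divide_distrib)
    then show ?thesis using pos by simp
  qed
  have \<gamma>_eq: "\<gamma> = \<eta> * (\<alpha> - \<beta>) / 2 + \<bar>\<eta> * (\<alpha> + \<beta>) / 2 - 1\<bar>"
  proof -
    have "\<eta> / \<eta>star * ((\<mu> - 1) / (\<mu> + 1)) = \<eta> * ((\<alpha> + \<beta>) * ((\<mu> - 1) / (\<mu> + 1))) / 2"
      by (simp add: assms(7) mult.assoc)
    also have "(\<alpha> + \<beta>) * ((\<mu> - 1) / (\<mu> + 1)) = \<alpha> - \<beta>" using pos by (simp add: ratio)
    finally show ?thesis by (simp add: assms(15) assms(7))
  qed
  \<comment> \<open>A maximum is half the sum plus half the absolute difference of its arguments;
    \<open>\<gamma>\<close> is exactly the contraction factor required for \<open>c\<close>.\<close>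
  have \<gamma>_max: "\<gamma> = max (\<eta> * \<alpha> - 1) (1 - \<eta> * \<beta>)"
    unfolding \<gamma>_eq
    by (simp add: max_def abs_if algebra_simps diff_divide_distrib add_divide_distrib)
  have "\<eta> * \<beta> \<le> \<eta> * \<alpha>" using le \<open>\<eta> > 0\<close> by simp
  then have c: "\<bar>1 - \<eta> * \<alpha>\<bar> \<le> \<gamma>" "\<bar>1 - \<eta> * \<beta>\<bar> \<le> \<gamma>"
    unfolding \<gamma>_max abs_le_iff le_max_iff_disj by linarith+
  have "\<gamma> \<ge> 0" using c by linarith
  have feas: "supp (\<theta> i) \<in> sparsity_model C" "norm (\<theta> i) \<le> r" for i
  proof -
    have "supp (\<theta> i) \<in> sparsity_model C \<and> norm (\<theta> i) \<le> r"
    proof (cases i)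
      case 0
      then show ?thesis using S \<open>r > 0\<close> assms(13) by (auto simp: sparsity_model_def supp_def)
    next
      case (Suc j)
      then show ?thesis using assms(14)[of j] by (simp add: is_projection_def is_arg_min_def)
    qed
    then show "supp (\<theta> i) \<in> sparsity_model C" "norm (\<theta> i) \<le> r" by auto
  qed
  have step: "norm (\<theta> (Suc i) - \<theta>bar) \<le> 2 * \<gamma> * norm (\<theta> i - \<theta>bar) + 2 * \<eta> * G" for i
  proof -
    define J where "J = supp (\<theta> (Suc i)) \<union> supp \<theta>bar"
    define w where "w = \<theta> i - \<theta>bar - \<eta> *\<^sub>R (nabla f (\<theta> i) - nabla f \<theta>bar)"
    \<comment> \<open>Two supports make up \<open>J\<close>, matching the projection that defines
      \<open>Ibar\<close>; the current iterate adds the third, hence the triple join for the Hessian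
      bounds.\<close>
    have J: "J \<in> sparsity_model (family_join C C)"
      unfolding J_def by (intro sparsity_model_join feas assms(8))
    have U: "J \<union> supp (\<theta> i) \<in> sparsity_model D"
      unfolding D_def by (intro sparsity_model_join J feas)
    have w: "norm (restrict_coords J w) \<le> \<gamma> * norm (\<theta> i - \<theta>bar)"
      unfolding w_def
      by (rule gradient_step_contraction[OF assms(4) hb U])
        (use feas assms(9,12) c in \<open>auto simp: J_def\<close>)
    have g: "norm (restrict_coords J (nabla f \<theta>bar)) \<le> G"
      unfolding G_def assms(11)
      by (rule projection_selects_largest_restriction[OF assms(10) \<open>r > 0\<close> J])
    have "norm (\<theta> (Suc i) - \<theta>bar)
        \<le> 2 * norm (restrict_coords J (\<theta> i - \<eta> *\<^sub>R nabla f (\<theta> i) - \<theta>bar))"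
      by (rule projection_error[OF assms(14,8,9)]) (simp add: J_def)
    also have "\<theta> i - \<eta> *\<^sub>R nabla f (\<theta> i) - \<theta>bar = w - \<eta> *\<^sub>R nabla f \<theta>bar"
      by (simp add: w_def algebra_simps)
    also have "norm (restrict_coords J \<dots>)
        \<le> norm (restrict_coords J w) + \<eta> * norm (restrict_coords J (nabla f \<theta>bar))"
      using norm_triangle_ineq4[of "restrict_coords J w" "\<eta> *\<^sub>R restrict_coords J (nabla f \<theta>bar)"]
        \<open>\<eta> > 0\<close> by (simp add: restrict_coords_diff restrict_coords_scale)
    also have "\<dots> \<le> \<gamma> * norm (\<theta> i - \<theta>bar) + \<eta> * G"
      using w g \<open>\<eta> > 0\<close> by (intro add_mono) auto
    finally show ?thesis by simp
  qed
  \<comment> \<open>Unrolling \<open>step\<close> starts from \<open>norm \<theta>bar\<close>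
    because \<open>\<theta> 0 = 0\<close>.\<close>
  have main: "norm (\<theta> i - \<theta>bar)
      \<le> (2 * \<gamma>) ^ i * norm \<theta>bar + 2 * \<eta> * ((1 - (2 * \<gamma>) ^ i) / (1 - 2 * \<gamma>)) * G"
    if "2 * \<gamma> \<noteq> 1" for i
    using affine_recursion_bound[of "\<lambda>i. norm (\<theta> i - \<theta>bar)", OF step _ that, of i]
      \<open>\<gamma> \<ge> 0\<close> assms(13) by (simp add: mult_ac)
  have rateI: "2 * \<gamma> < 1" if "2 * (\<eta> * \<alpha>) < 3" "1 < 2 * (\<eta> * \<beta>)"
    using that by (simp add: \<gamma>_max max_def)
  have rate: "2 * \<gamma> < 1" if "(\<mu> < 3 \<and> \<eta> = \<eta>star) \<or> (\<mu> < 3 / 2 \<and> \<eta> \<in> {1 / \<alpha>..1 / \<beta>})"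
    using that
  proof
    assume "\<mu> < 3 \<and> \<eta> = \<eta>star"
    then have \<alpha>: "\<alpha> < 3 * \<beta>" and "\<eta> = 2 / (\<alpha> + \<beta>)"
      using pos assms(6,7) by (auto simp: field_simps)
    \<comment> \<open>With this sum, \<open>\<eta> * \<alpha> < 3 * (\<eta> * \<beta>)\<close>
      forces \<open>\<eta> * \<beta> > 1/2\<close> and
      \<open>\<eta> * \<alpha> < 3/2\<close>.\<close>
    then have "\<eta> * \<alpha> + \<eta> * \<beta> = 2"
      using pos nonzero_eq_divide_eq[of "\<alpha> + \<beta>" \<eta> 2] by (simp add: distrib_left)
    moreover have "\<eta> * \<alpha> < \<eta> * (3 * \<beta>)" using \<alpha> \<open>\<eta> > 0\<close> by simp
    ultimately show ?thesis by (intro rateI) linarith+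
  next
    assume "\<mu> < 3 / 2 \<and> \<eta> \<in> {1 / \<alpha>..1 / \<beta>}"
    then have \<alpha>: "2 * \<alpha> < 3 * \<beta>" and \<eta>: "1 \<le> \<eta> * \<alpha>" "\<eta> * \<beta> \<le> 1"
      using pos assms(6) by (auto simp: pos_divide_less_eq pos_divide_le_eq pos_le_divide_eq)
    \<comment> \<open>Combined with \<open>\<eta> * \<beta> \<le> 1\<close> this gives
      \<open>\<eta> * \<alpha> < 3/2\<close>; combined with \<open>1 \<le> \<eta> * \<alpha>\<close>
      it gives \<open>\<eta> * \<beta> > 2/3\<close>.\<close>
    have "\<eta> * (2 * \<alpha>) < \<eta> * (3 * \<beta>)" using \<alpha> \<open>\<eta> > 0\<close> by simp
    with \<eta> show ?thesis by (intro rateI) linarith+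
  qed
  have limit: "norm (\<theta> i - \<theta>bar) \<le> (2 * \<gamma>) ^ i * norm \<theta>bar + 2 * \<eta> / (1 - 2 * \<gamma>) * G"
    if "2 * \<gamma> < 1" for i
  proof -
    \<comment> \<open>Since \<open>\<gamma> \<ge> 0\<close>, the numerator
      \<open>1 - (2 * \<gamma>) ^ i\<close> is at most 1.\<close>
    have "2 * \<eta> * ((1 - (2 * \<gamma>) ^ i) / (1 - 2 * \<gamma>)) * G \<le> 2 * \<eta> * (1 / (1 - 2 * \<gamma>)) * G"
      using that \<open>\<gamma> \<ge> 0\<close> \<open>\<eta> > 0\<close>
      by (intro mult_right_mono mult_left_mono divide_right_mono) (auto simp: G_def)
    then show ?thesis using main[of i] that by simp
  qed
  show ?thesis
    unfolding G_def[symmetric] by (intro conjI impI allI main limit rate)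
qed

end
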